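(* Let $\mathbf L$ be the logic $\mathbf{RmbC}$ or any axiomatic extension of it over the signature $\Sigma$ (i.e. obtained by adding axiom schemas over $\Sigma$), in which derivation from premises is defined as in $\mathbf{RmbC}$. Then $\mathbf L$ satisfies the replacement property: if $\alpha\leftrightarrow\beta$ is a theorem of $\mathbf L$, then $\gamma[p/\alpha]\leftrightarrow\gamma[p/\beta]$ is a theorem of $\mathbf L$, for every formula $\gamma(p)$.
   Context: Let $\Sigma=\{\wedge,\vee,\to,\neg,\circ\}$ ($\neg,\circ$ unary, the others binary) and let $For(\Sigma)$ be the set of formulas over $\Sigma$ generated by a denumerable set $\mathcal V$ of propositional variables. $\alpha\leftrightarrow\beta$ abbreviates $(\alpha\to\beta)\wedge(\beta\to\alpha)$, and $\gamma[p/\alpha]$ denotes the formula obtained from $\gamma$ by replacing every occurrence of the variable $p$ by $\alpha$. $\mathbf{RmbC}$ is the Hilbert calculus with axiom schemas: (Ax1) $\alpha\to(\beta\to\alpha)$; (Ax2) $(\alpha\to(\beta\to\gamma))\to((\alpha\to\beta)\to(\alpha\to\gamma))$; (Ax3) $\alpha\to(\beta\to(\alpha\wedge\beta))$; (Ax4) $(\alpha\wedge\beta)\to\alpha$; (Ax5) $(\alpha\wedge\beta)\to\beta$; (Ax6) $\alpha\to(\alpha\vee\beta)$; (Ax7) $\beta\to(\alpha\vee\beta)$; (Ax8) $(\alpha\to\gamma)\to((\beta\to\gamma)\to((\alpha\vee\beta)\to\gamma))$; (Ax9) $(\alpha\to\beta)\vee\alpha$; (Ax10) $\alpha\vee\neg\alpha$;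 (bc1) $\circ\alpha\to(\alpha\to(\neg\alpha\to\beta))$; and rules: (MP) from $\alpha$ and $\alpha\to\beta$ infer $\beta$; $(\mathbf R_\neg)$ from $\alpha\leftrightarrow\beta$ infer $\neg\alpha\leftrightarrow\neg\beta$; $(\mathbf R_\circ)$ from $\alpha\leftrightarrow\beta$ infer $\circ\alpha\leftrightarrow\circ\beta$. A formula $\varphi$ is a theorem ($\vdash\varphi$) if there is a finite sequence of formulas ending in $\varphi$ each of which is an instance of an axiom schema or follows from earlier formulas of the sequence by a rule. $\Gamma\vdash\varphi$ means that either $\vdash\varphi$ or there is a finite non-empty $\{\gamma_1,\dots,\gamma_n\}\subseteq\Gamma$ with $\vdash(\gamma_1\wedge(\gamma_2\wedge(\cdots\wedge(\gamma_{n-1}\wedge\gamma_n)\cdots)))\to\varphi$. *)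

theory Defs
  imports Main
begin

datatype fm =
    Var nat
  | Conj fm fm  (infixr "\<^bold>\<and>" 55)
  | Disj fm fm  (infixr "\<^bold>\<or>" 54)
  | Imp fm fm   (infixr "\<^bold>\<rightarrow>" 53)
  | Neg fm      ("\<^bold>\<not> _" [60] 60)
  | Circ fm     ("\<^bold>\<circ> _" [60] 60)

abbreviation Iff :: "fm \<Rightarrow> fm \<Rightarrow> fm"  (infix "\<^bold>\<leftrightarrow>" 52)
  where "\<alpha> \<^bold>\<leftrightarrow> \<beta> \<equiv> (\<alpha> \<^bold>\<rightarrow> \<beta>) \<^bold>\<and> (\<beta> \<^bold>\<rightarrow> \<alpha>)"

primrec subst :: "(nat \<Rightarrow> fm) \<Rightarrow> fm \<Rightarrow> fm" where
  "subst \<sigma> (Var q) = \<sigma> q"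
| "subst \<sigma> (\<alpha> \<^bold>\<and> \<beta>) = subst \<sigma> \<alpha> \<^bold>\<and> subst \<sigma> \<beta>"
| "subst \<sigma> (\<alpha> \<^bold>\<or> \<beta>) = subst \<sigma> \<alpha> \<^bold>\<or> subst \<sigma> \<beta>"
| "subst \<sigma> (\<alpha> \<^bold>\<rightarrow> \<beta>) = (subst \<sigma> \<alpha> \<^bold>\<rightarrow> subst \<sigma> \<beta>)"
| "subst \<sigma> (\<^bold>\<not> \<alpha>) = \<^bold>\<not> (subst \<sigma> \<alpha>)"
| "subst \<sigma> (\<^bold>\<circ> \<alpha>) = \<^bold>\<circ> (subst \<sigma> \<alpha>)"

definition replace_var :: "fm \<Rightarrow> nat \<Rightarrow> fm \<Rightarrow> fm"  ("_\<langle>_'/_\<rangle>" [1000, 0, 0] 1000)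
  where "\<gamma>\<langle>p/\<alpha>\<rangle> = subst (Var(p := \<alpha>)) \<gamma>"

inductive_set RmbC_axioms :: "fm set" where
  Ax1:  "\<alpha> \<^bold>\<rightarrow> (\<beta> \<^bold>\<rightarrow> \<alpha>) \<in> RmbC_axioms"
| Ax2:  "(\<alpha> \<^bold>\<rightarrow> (\<beta> \<^bold>\<rightarrow> \<gamma>)) \<^bold>\<rightarrow> ((\<alpha> \<^bold>\<rightarrow> \<beta>) \<^bold>\<rightarrow> (\<alpha> \<^bold>\<rightarrow> \<gamma>)) \<in> RmbC_axioms"
| Ax3:  "\<alpha> \<^bold>\<rightarrow> (\<beta> \<^bold>\<rightarrow> (\<alpha> \<^bold>\<and> \<beta>)) \<in> RmbC_axioms"
| Ax4:  "(\<alpha> \<^bold>\<and> \<beta>) \<^bold>\<rightarrow> \<alpha> \<in> RmbC_axioms"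
| Ax5:  "(\<alpha> \<^bold>\<and> \<beta>) \<^bold>\<rightarrow> \<beta> \<in> RmbC_axioms"
| Ax6:  "\<alpha> \<^bold>\<rightarrow> (\<alpha> \<^bold>\<or> \<beta>) \<in> RmbC_axioms"
| Ax7:  "\<beta> \<^bold>\<rightarrow> (\<alpha> \<^bold>\<or> \<beta>) \<in> RmbC_axioms"
| Ax8:  "(\<alpha> \<^bold>\<rightarrow> \<gamma>) \<^bold>\<rightarrow> ((\<beta> \<^bold>\<rightarrow> \<gamma>) \<^bold>\<rightarrow> ((\<alpha> \<^bold>\<or> \<beta>) \<^bold>\<rightarrow> \<gamma>)) \<in> RmbC_axioms"
| Ax9:  "(\<alpha> \<^bold>\<rightarrow> \<beta>) \<^bold>\<or> \<alpha> \<in> RmbC_axioms"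
| Ax10: "\<alpha> \<^bold>\<or> \<^bold>\<not> \<alpha> \<in> RmbC_axioms"
| bc1:  "\<^bold>\<circ> \<alpha> \<^bold>\<rightarrow> (\<alpha> \<^bold>\<rightarrow> (\<^bold>\<not> \<alpha> \<^bold>\<rightarrow> \<beta>)) \<in> RmbC_axioms"

text \<open>
  An additional axiom schema is given by a formula whose variables play the role of
  schematic letters: its instances are all its uniform substitution instances.  A (possibly
  infinite) set \<open>A\<close> of such schemas determines the axiomatic extension of RmbC by \<open>A\<close>;
  RmbC itself is the case \<open>A = {}\<close>.
\<close>

definition axiom_instances :: "fm set \<Rightarrow> fm set" where
  "axiom_instances A = RmbC_axioms \<union> {subst \<sigma> \<chi> | \<sigma> \<chi>. \<chi> \<in> A}"

inductive follows :: "fm set \<Rightarrow> fm \<Rightarrow> bool" for \<Phi> where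
  MP:     "\<alpha> \<in> \<Phi> \<Longrightarrow> \<alpha> \<^bold>\<rightarrow> \<beta> \<in> \<Phi> \<Longrightarrow> follows \<Phi> \<beta>"
| R_neg:  "\<alpha> \<^bold>\<leftrightarrow> \<beta> \<in> \<Phi> \<Longrightarrow> follows \<Phi> (\<^bold>\<not> \<alpha> \<^bold>\<leftrightarrow> \<^bold>\<not> \<beta>)"
| R_circ: "\<alpha> \<^bold>\<leftrightarrow> \<beta> \<in> \<Phi> \<Longrightarrow> follows \<Phi> (\<^bold>\<circ> \<alpha> \<^bold>\<leftrightarrow> \<^bold>\<circ> \<beta>)"

definition is_derivation :: "fm set \<Rightarrow> fm list \<Rightarrow> bool" where
  "is_derivation A \<phi>s \<longleftrightarrow>
     (\<forall>i < length \<phi>s. \<phi>s ! i \<in> axiom_instances A \<or> follows (set (take i \<phi>s)) (\<phi>s ! i))"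

definition theorem_of :: "fm set \<Rightarrow> fm \<Rightarrow> bool" where
  "theorem_of A \<phi> \<longleftrightarrow> (\<exists>\<phi>s. \<phi>s \<noteq> [] \<and> last \<phi>s = \<phi> \<and> is_derivation A \<phi>s)"

fun conj_list :: "fm list \<Rightarrow> fm" where
  "conj_list [] = undefined"
| "conj_list [\<gamma>] = \<gamma>"
| "conj_list (\<gamma> # \<gamma>s) = \<gamma> \<^bold>\<and> conj_list \<gamma>s"

definition derives :: "fm set \<Rightarrow> fm set \<Rightarrow> fm \<Rightarrow> bool" where
  "derives A \<Gamma> \<phi> \<longleftrightarrow>
     theorem_of A \<phi> \<or>
     (\<exists>\<gamma>s. \<gamma>s \<noteq> [] \<and> set \<gamma>s \<subseteq> \<Gamma> \<and> theorem_of A (conj_list \<gamma>s \<^bold>\<rightarrow> \<phi>))"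

text \<open>The theorems of an extension are exactly what it derives from no premises.\<close>

lemma derives_empty: "derives A {} \<phi> \<longleftrightarrow> theorem_of A \<phi>"
  by (auto simp: derives_def)

end

theory Submission
  imports Defs
begin

text \<open>Provable equivalence is a congruence for all five connectives, so replacement follows by
  structural induction on the formula. For negation and \<open>Circ\<close> the congruence is
  exactly what the rules \<open>R_neg\<close> and \<open>R_circ\<close> give, and these apply to
  every theorem of an extension because extra schemas only enlarge the stock of axioms. For the
  binary connectives it comes from the positive axioms: conjunction and disjunction are monotone in
  both arguments, while implication is antitone on the left and monotone on the right
  (\<open>theorem_of_Conj_mono\<close>, \<open>theorem_of_Disj_mono\<close>,
  \<open>theorem_of_Imp_mono\<close>). The argument is uniform in \<open>A\<close>. The induction
  itself is \<open>theorem_of_subst_cong\<close>; the lemmas on lists show that the set of theorems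
  contains the axioms of RmbC and is closed under the rules.\<close>

lemma follows_mono: "follows \<Phi> \<phi> \<Longrightarrow> \<Phi> \<subseteq> \<Psi> \<Longrightarrow> follows \<Psi> \<phi>"
  by (induction rule: follows.induct) (auto intro: follows.intros)

text \<open>Placing a derivation after another only adds predecessors to its formulas, and
  \<open>follows\<close> is monotone in the set of predecessors. This lets the two premises of modus
  ponens, derived separately, occur in one list.\<close>

lemma is_derivation_append:
  assumes "is_derivation A \<phi>s" "is_derivation A \<psi>s"
  shows "is_derivation A (\<phi>s @ \<psi>s)"
  unfolding is_derivation_def
proof (intro allI impI)
  fix i assume i: "i < length (\<phi>s @ \<psi>s)"
  show "(\<phi>s @ \<psi>s) ! i \<in> axiom_instances A \<or> follows (set (take i (\<phi>s @ \<psi>s))) ((\<phi>s @ \<psi>s) ! i)"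
  proof (cases "i < length \<phi>s")
    case True
    then show ?thesis using assms(1) by (auto simp: is_derivation_def nth_append)
  next
    case False
    with i have "i - length \<phi>s < length \<psi>s" by auto
    with assms(2) have "\<psi>s ! (i - length \<phi>s) \<in> axiom_instances A \<or>
        follows (set (take (i - length \<phi>s) \<psi>s)) (\<psi>s ! (i - length \<phi>s))"
      by (auto simp: is_derivation_def)
    with False show ?thesis
      by (auto simp: nth_append intro: follows_mono)
  qed
qed

lemma is_derivation_snoc:
  assumes "is_derivation A \<phi>s" "\<phi> \<in> axiom_instances A \<or> follows (set \<phi>s) \<phi>"
  shows "is_derivation A (\<phi>s @ [\<phi>])"
  using assms by (auto simp: is_derivation_def nth_append less_Suc_eq)

lemma theorem_of_snoc:
  assumes "is_derivation A \<phi>s" "\<phi> \<in> axiom_instances A \<or> follows (set \<phi>s) \<phi>"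
  shows "theorem_of A \<phi>"
  using is_derivation_snoc[OF assms] unfolding theorem_of_def
  by (intro exI[of _ "\<phi>s @ [\<phi>]"]) simp

text \<open>Membership is kept in place of being the last formula: it survives concatenation, and it
  is all that a rule asks of its premises.\<close>

lemma theorem_ofE:
  assumes "theorem_of A \<phi>"
  obtains \<phi>s where "is_derivation A \<phi>s" "\<phi> \<in> set \<phi>s"
  using assms by (auto simp: theorem_of_def)

lemma theorem_of_axiom: "\<phi> \<in> RmbC_axioms \<Longrightarrow> theorem_of A \<phi>"
  by (rule theorem_of_snoc[of _ "[]"]) (auto simp: is_derivation_def axiom_instances_def)

lemma theorem_of_MP:
  assumes "theorem_of A (\<alpha> \<^bold>\<rightarrow> \<beta>)" "theorem_of A \<alpha>"
  shows "theorem_of A \<beta>"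
proof -
  obtain \<phi>s \<psi>s where "is_derivation A \<phi>s" "(\<alpha> \<^bold>\<rightarrow> \<beta>) \<in> set \<phi>s" "is_derivation A \<psi>s" "\<alpha> \<in> set \<psi>s"
    using assms by (meson theorem_ofE)
  then show ?thesis
    by (intro theorem_of_snoc[of A "\<phi>s @ \<psi>s"]) (auto intro: is_derivation_append follows.MP)
qed

text \<open>A derivation of the premise is extended by one application of \<open>R_neg\<close>. The
  rule leads from theorem to theorem; no implication between the two equivalences is
  asserted.\<close>

lemma theorem_of_Neg_cong:
  "theorem_of A (\<alpha> \<^bold>\<leftrightarrow> \<beta>) \<Longrightarrow> theorem_of A (\<^bold>\<not> \<alpha> \<^bold>\<leftrightarrow> \<^bold>\<not> \<beta>)"
  by (elim theorem_ofE) (blast intro: theorem_of_snoc follows.R_neg)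

lemma theorem_of_Circ_cong:
  "theorem_of A (\<alpha> \<^bold>\<leftrightarrow> \<beta>) \<Longrightarrow> theorem_of A (\<^bold>\<circ> \<alpha> \<^bold>\<leftrightarrow> \<^bold>\<circ> \<beta>)"
  by (elim theorem_ofE) (blast intro: theorem_of_snoc follows.R_circ)

lemma theorem_of_ConjI:
  "theorem_of A \<alpha> \<Longrightarrow> theorem_of A \<beta> \<Longrightarrow> theorem_of A (\<alpha> \<^bold>\<and> \<beta>)"
  by (meson theorem_of_MP theorem_of_axiom RmbC_axioms.Ax3)

lemma theorem_of_IffD:
  assumes "theorem_of A (\<alpha> \<^bold>\<leftrightarrow> \<beta>)"
  shows "theorem_of A (\<alpha> \<^bold>\<rightarrow> \<beta>)" "theorem_of A (\<beta> \<^bold>\<rightarrow> \<alpha>)"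
  using assms by (meson theorem_of_MP theorem_of_axiom RmbC_axioms.Ax4 RmbC_axioms.Ax5)+

lemma theorem_of_weaken: "theorem_of A \<beta> \<Longrightarrow> theorem_of A (\<alpha> \<^bold>\<rightarrow> \<beta>)"
  by (meson theorem_of_MP theorem_of_axiom RmbC_axioms.Ax1)

lemma theorem_of_Imp_MP:
  "theorem_of A (\<alpha> \<^bold>\<rightarrow> (\<beta> \<^bold>\<rightarrow> \<gamma>)) \<Longrightarrow> theorem_of A (\<alpha> \<^bold>\<rightarrow> \<beta>) \<Longrightarrow> theorem_of A (\<alpha> \<^bold>\<rightarrow> \<gamma>)"
  by (meson theorem_of_MP theorem_of_axiom RmbC_axioms.Ax2)

lemma theorem_of_Imp_trans:
  "theorem_of A (\<alpha> \<^bold>\<rightarrow> \<beta>) \<Longrightarrow> theorem_of A (\<beta> \<^bold>\<rightarrow> \<gamma>) \<Longrightarrow> theorem_of A (\<alpha> \<^bold>\<rightarrow> \<gamma>)"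
  by (meson theorem_of_weaken theorem_of_Imp_MP)

text \<open>The combinator identity I = S K K: \<open>theorem_of_Imp_MP\<close> plays S, and both of
  its premises are instances of \<open>Ax1\<close>.\<close>

lemma theorem_of_Imp_refl: "theorem_of A (\<alpha> \<^bold>\<rightarrow> \<alpha>)"
  by (meson theorem_of_Imp_MP theorem_of_axiom RmbC_axioms.Ax1)

lemma theorem_of_Conj_mono:
  assumes "theorem_of A (\<alpha> \<^bold>\<rightarrow> \<alpha>')" "theorem_of A (\<beta> \<^bold>\<rightarrow> \<beta>')"
  shows "theorem_of A ((\<alpha> \<^bold>\<and> \<beta>) \<^bold>\<rightarrow> (\<alpha>' \<^bold>\<and> \<beta>'))"
proof -
  have "theorem_of A ((\<alpha> \<^bold>\<and> \<beta>) \<^bold>\<rightarrow> \<alpha>')" "theorem_of A ((\<alpha> \<^bold>\<and> \<beta>) \<^bold>\<rightarrow> \<beta>')"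
    using assms
    by (blast intro: theorem_of_Imp_trans theorem_of_axiom RmbC_axioms.Ax4 RmbC_axioms.Ax5)+
  then show ?thesis
    by (meson theorem_of_Imp_MP theorem_of_Imp_trans theorem_of_axiom RmbC_axioms.Ax3)
qed

lemma theorem_of_Disj_mono:
  assumes "theorem_of A (\<alpha> \<^bold>\<rightarrow> \<alpha>')" "theorem_of A (\<beta> \<^bold>\<rightarrow> \<beta>')"
  shows "theorem_of A ((\<alpha> \<^bold>\<or> \<beta>) \<^bold>\<rightarrow> (\<alpha>' \<^bold>\<or> \<beta>'))"
proof -
  have "theorem_of A (\<alpha> \<^bold>\<rightarrow> (\<alpha>' \<^bold>\<or> \<beta>'))" "theorem_of A (\<beta> \<^bold>\<rightarrow> (\<alpha>' \<^bold>\<or> \<beta>'))"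
    using assms
    by (blast intro: theorem_of_Imp_trans theorem_of_axiom RmbC_axioms.Ax6 RmbC_axioms.Ax7)+
  then show ?thesis
    by (meson theorem_of_MP theorem_of_axiom RmbC_axioms.Ax8)
qed

lemma theorem_of_Imp_mono:
  assumes "theorem_of A (\<alpha>' \<^bold>\<rightarrow> \<alpha>)" "theorem_of A (\<beta> \<^bold>\<rightarrow> \<beta>')"
  shows "theorem_of A ((\<alpha> \<^bold>\<rightarrow> \<beta>) \<^bold>\<rightarrow> (\<alpha>' \<^bold>\<rightarrow> \<beta>'))"
proof -
  have "theorem_of A ((\<alpha> \<^bold>\<rightarrow> \<beta>) \<^bold>\<rightarrow> ((\<alpha>' \<^bold>\<rightarrow> \<alpha>) \<^bold>\<rightarrow> (\<alpha>' \<^bold>\<rightarrow> \<beta>)))"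
    by (rule theorem_of_Imp_trans; rule theorem_of_axiom, rule RmbC_axioms.Ax1 RmbC_axioms.Ax2)
  then have "theorem_of A ((\<alpha> \<^bold>\<rightarrow> \<beta>) \<^bold>\<rightarrow> (\<alpha>' \<^bold>\<rightarrow> \<beta>))"
    by (rule theorem_of_Imp_MP) (rule theorem_of_weaken[OF assms(1)])
  moreover have "theorem_of A ((\<alpha>' \<^bold>\<rightarrow> \<beta>) \<^bold>\<rightarrow> (\<alpha>' \<^bold>\<rightarrow> \<beta>'))"
    using theorem_of_weaken[OF assms(2)] by (meson theorem_of_MP theorem_of_axiom RmbC_axioms.Ax2)
  ultimately show ?thesis
    by (rule theorem_of_Imp_trans)
qed

text \<open>Stated for two substitutions that are equivalent at each variable, so that the variable
  case is the hypothesis itself and needs no distinction between p and the other variables.\<close>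

lemma theorem_of_subst_cong:
  assumes "\<And>q. theorem_of A (\<sigma> q \<^bold>\<leftrightarrow> \<tau> q)"
  shows "theorem_of A (subst \<sigma> \<gamma> \<^bold>\<leftrightarrow> subst \<tau> \<gamma>)"
proof (induction \<gamma>)
  case (Var q)
  then show ?case using assms by simp
next
  case (Conj \<gamma>1 \<gamma>2)
  then show ?case
    by (auto dest: theorem_of_IffD intro!: theorem_of_ConjI theorem_of_Conj_mono)
next
  case (Disj \<gamma>1 \<gamma>2)
  then show ?case
    by (auto dest: theorem_of_IffD intro!: theorem_of_ConjI theorem_of_Disj_mono)
next
  case (Imp \<gamma>1 \<gamma>2)
  then show ?case
    by (auto dest: theorem_of_IffD intro!: theorem_of_ConjI theorem_of_Imp_mono)
next
  case (Neg \<gamma>)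
  then show ?case by (simp add: theorem_of_Neg_cong)
next
  case (Circ \<gamma>)
  then show ?case by (simp add: theorem_of_Circ_cong)
qed

theorem theorem2p8:
  fixes A :: "fm set" and \<alpha> \<beta> \<gamma> :: fm and p :: nat
  assumes "theorem_of A (\<alpha> \<^bold>\<leftrightarrow> \<beta>)"
  shows "theorem_of A (\<gamma>\<langle>p/\<alpha>\<rangle> \<^bold>\<leftrightarrow> \<gamma>\<langle>p/\<beta>\<rangle>)"
  unfolding replace_var_def
  \<comment> \<open>At p the two substitutions give the assumed equivalence; any other variable is
    fixed by both, and reflexivity of implication suffices.\<close>
  using assms by (intro theorem_of_subst_cong) (simp add: theorem_of_ConjI theorem_of_Imp_refl)

end
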